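(* Let $n\geq 1$ and let $S_n$ be the symmetric group. The irreducible quandle representations of $Conj(S_n)$ over $\mathbb{C}$ are exactly the representations of the form $\chi\cdot\rho$, where $\chi$ is a character of the quandle $Conj(S_n)$ and $\rho$ is an irreducible complex linear group representation of $S_n$ (viewed as a quandle representation of $Conj(S_n)$).
   Context: For a group $G$, $Conj(G)$ is the quandle with underlying set $G$ and operation $x\triangleright y=xyx^{-1}$. A quandle representation of a quandle $Q$ on a complex vector space $V$ is a map $\rho:Q\to GL(V)$ with $\rho(x\triangleright y)=\rho(x)\rho(y)\rho(x)^{-1}$ for all $x,y\in Q$. A subrepresentation is a subspace $W\subset V$ with $\rho(x)(W)\subset W$ for all $x\in Q$; $\rho$ is irreducible if $V\neq 0$ and its only subrepresentations are $0$ and $V$. A character of a quandle $Q$ is a map $\chi:Q\to\mathbb{C}^\times$ with $\chi(x\triangleright y)=\chi(y)$ for all $x,y\in Q$; for a quandle representation $\rho$, $(\chi\cdot\rho)(x)=\chi(x)\rho(x)$. A group representation of $G$ is in particular a quandle representation of $Conj(G)$. *)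

theory Defs
  imports Complex_Main "HOL-Algebra.Sym_Groups"
begin

record 'a quandle = "'a partial_object" +
  tri :: "'a \<Rightarrow> 'a \<Rightarrow> 'a"  (infixl "\<triangleright>\<index>" 70)

locale quandle =
  fixes Q (structure)
  assumes tri_bij: "x \<in> carrier Q \<Longrightarrow> bij_betw (\<lambda>y. x \<triangleright> y) (carrier Q) (carrier Q)"
    and tri_distrib: "\<lbrakk>x \<in> carrier Q; y \<in> carrier Q; z \<in> carrier Q\<rbrakk>
      \<Longrightarrow> x \<triangleright> (y \<triangleright> z) = (x \<triangleright> y) \<triangleright> (x \<triangleright> z)"
    and tri_idem: "x \<in> carrier Q \<Longrightarrow> x \<triangleright> x = x"

definition Conj :: "('a, 'm) monoid_scheme \<Rightarrow> 'a quandle" where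
  "Conj G = \<lparr>carrier = carrier G, tri = (\<lambda>x y. x \<otimes>\<^bsub>G\<^esub> y \<otimes>\<^bsub>G\<^esub> inv\<^bsub>G\<^esub> x)\<rparr>"

lemma Conj_simps [simp]:
  "carrier (Conj G) = carrier G"
  "x \<triangleright>\<^bsub>Conj G\<^esub> y = x \<otimes>\<^bsub>G\<^esub> y \<otimes>\<^bsub>G\<^esub> inv\<^bsub>G\<^esub> x"
  by (simp_all add: Conj_def)

lemma (in group) inv_cancel:
  assumes "x \<in> carrier G" "y \<in> carrier G"
  shows "inv x \<otimes> (x \<otimes> y) = y" "x \<otimes> (inv x \<otimes> y) = y"
  using assms by (simp_all flip: m_assoc)

lemma (in group) quandle_Conj: "quandle (Conj G)"
proof
  fix x assume x: "x \<in> carrier (Conj G)"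
  show "bij_betw (\<lambda>y. x \<triangleright>\<^bsub>Conj G\<^esub> y) (carrier (Conj G)) (carrier (Conj G))"
    using x by (intro bij_betwI[where g = "\<lambda>y. inv x \<otimes> y \<otimes> x"])
      (auto simp: m_assoc inv_cancel)
  show "x \<triangleright>\<^bsub>Conj G\<^esub> x = x" using x by (simp add: m_assoc)
next
  fix x y z assume "x \<in> carrier (Conj G)" "y \<in> carrier (Conj G)" "z \<in> carrier (Conj G)"
  then show "x \<triangleright>\<^bsub>Conj G\<^esub> (y \<triangleright>\<^bsub>Conj G\<^esub> z)
    = (x \<triangleright>\<^bsub>Conj G\<^esub> y) \<triangleright>\<^bsub>Conj G\<^esub> (x \<triangleright>\<^bsub>Conj G\<^esub> z)"
    by (simp add: m_assoc inv_mult_group inv_cancel)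
qed

text \<open>Vector spaces are given by their scalar multiplication; the space is the whole
  type and may be infinite-dimensional.\<close>

definition GL :: "('k::field \<Rightarrow> 'v::ab_group_add \<Rightarrow> 'v) \<Rightarrow> ('v \<Rightarrow> 'v) monoid" where
  "GL scale = \<lparr>carrier = {f. Vector_Spaces.linear scale scale f \<and> bij f},
     monoid.mult = (\<circ>), one = id\<rparr>"

lemma (in vector_space) group_GL: "group (GL scale)"
proof (rule groupI)
  fix f assume "f \<in> carrier (GL scale)"
  then have f: "Vector_Spaces.linear scale scale f" "bij f" by (auto simp: GL_def)
  interpret f: Vector_Spaces.linear scale scale f by fact
  have surj: "f (inv_into UNIV f v) = v" for v
    using f(2) by (simp add: bij_is_surj surj_f_inv_f)
  have inj: "inv_into UNIV f (f v) = v" for v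
    using f(2) by (simp add: bij_is_inj)
  have "inv_into UNIV f (v + w) = inv_into UNIV f v + inv_into UNIV f w" for v w
    by (metis f.add surj inj)
  moreover have "inv_into UNIV f (scale c v) = scale c (inv_into UNIV f v)" for c v
    by (metis f.scale surj inj)
  ultimately have "Vector_Spaces.linear scale scale (inv_into UNIV f)"
    by unfold_locales
  then show "\<exists>g\<in>carrier (GL scale). g \<otimes>\<^bsub>GL scale\<^esub> f = \<one>\<^bsub>GL scale\<^esub>"
    using f(2) by (intro bexI[of _ "inv_into UNIV f"])
      (auto simp: GL_def bij_imp_bij_inv bij_is_inj)
next
  show "\<one>\<^bsub>GL scale\<^esub> \<in> carrier (GL scale)"
    using linear_id by (simp add: GL_def)
qed (auto simp: GL_def comp_assoc bij_comp intro: Vector_Spaces.linear_compose)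

text \<open>Irreducibility of a family of operators \<open>\<rho> x\<close>, \<open>x \<in> X\<close>; for representations,
  \<open>X\<close> is the carrier of the quandle or group.\<close>

definition subrep ::
    "('k::field \<Rightarrow> 'v::ab_group_add \<Rightarrow> 'v) \<Rightarrow> 'a set \<Rightarrow> ('a \<Rightarrow> 'v \<Rightarrow> 'v) \<Rightarrow> 'v set \<Rightarrow> bool" where
  "subrep scale X \<rho> W \<longleftrightarrow> module.subspace scale W \<and> (\<forall>x\<in>X. \<rho> x ` W \<subseteq> W)"

definition irreducible_action ::
    "('k::field \<Rightarrow> 'v::ab_group_add \<Rightarrow> 'v) \<Rightarrow> 'a set \<Rightarrow> ('a \<Rightarrow> 'v \<Rightarrow> 'v) \<Rightarrow> bool" where
  "irreducible_action scale X \<rho> \<longleftrightarrow>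
     (UNIV :: 'v set) \<noteq> {0} \<and> (\<forall>W. subrep scale X \<rho> W \<longrightarrow> W = {0} \<or> W = UNIV)"

definition quandle_rep ::
    "('a, 'm) quandle_scheme \<Rightarrow> (complex \<Rightarrow> 'v::ab_group_add \<Rightarrow> 'v) \<Rightarrow> ('a \<Rightarrow> 'v \<Rightarrow> 'v) \<Rightarrow> bool" where
  "quandle_rep Q scale \<rho> \<longleftrightarrow> quandle Q \<and> vector_space scale \<and>
     \<rho> \<in> carrier Q \<rightarrow> carrier (GL scale) \<and>
     (\<forall>x\<in>carrier Q. \<forall>y\<in>carrier Q.
        \<rho> (x \<triangleright>\<^bsub>Q\<^esub> y) = \<rho> x \<otimes>\<^bsub>GL scale\<^esub> \<rho> y \<otimes>\<^bsub>GL scale\<^esub> inv\<^bsub>GL scale\<^esub> (\<rho> x))"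

definition group_rep ::
    "('a, 'm) monoid_scheme \<Rightarrow> (complex \<Rightarrow> 'v::ab_group_add \<Rightarrow> 'v) \<Rightarrow> ('a \<Rightarrow> 'v \<Rightarrow> 'v) \<Rightarrow> bool" where
  "group_rep G scale \<rho> \<longleftrightarrow> group G \<and> vector_space scale \<and> \<rho> \<in> hom G (GL scale)"

definition irreducible_quandle_rep ::
    "('a, 'm) quandle_scheme \<Rightarrow> (complex \<Rightarrow> 'v::ab_group_add \<Rightarrow> 'v) \<Rightarrow> ('a \<Rightarrow> 'v \<Rightarrow> 'v) \<Rightarrow> bool" where
  "irreducible_quandle_rep Q scale \<rho> \<longleftrightarrow>
     quandle_rep Q scale \<rho> \<and> irreducible_action scale (carrier Q) \<rho>"

definition irreducible_group_rep ::
    "('a, 'm) monoid_scheme \<Rightarrow> (complex \<Rightarrow> 'v::ab_group_add \<Rightarrow> 'v) \<Rightarrow> ('a \<Rightarrow> 'v \<Rightarrow> 'v) \<Rightarrow> bool" where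
  "irreducible_group_rep G scale \<rho> \<longleftrightarrow>
     group_rep G scale \<rho> \<and> irreducible_action scale (carrier G) \<rho>"

definition quandle_character :: "('a, 'm) quandle_scheme \<Rightarrow> ('a \<Rightarrow> complex) \<Rightarrow> bool" where
  "quandle_character Q \<chi> \<longleftrightarrow> \<chi> \<in> carrier Q \<rightarrow> - {0} \<and>
     (\<forall>x\<in>carrier Q. \<forall>y\<in>carrier Q. \<chi> (x \<triangleright>\<^bsub>Q\<^esub> y) = \<chi> y)"

definition twist ::
    "(complex \<Rightarrow> 'v \<Rightarrow> 'v) \<Rightarrow> ('a \<Rightarrow> complex) \<Rightarrow> ('a \<Rightarrow> 'v \<Rightarrow> 'v) \<Rightarrow> 'a \<Rightarrow> 'v \<Rightarrow> 'v" where
  "twist scale \<chi> \<rho> = (\<lambda>x v. scale (\<chi> x) (\<rho> x v))"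

end

theory Submission imports Defs "HOL-Computational_Algebra.Fundamental_Theorem_Algebra"
    "HOL-Analysis.Continuum_Not_Denumerable" begin

text \<open>That a twist of an irreducible group representation by a character is an irreducible quandle
  representation is immediate: a nowhere vanishing scalar factor changes neither the conjugation
  relation, the character being constant on conjugacy classes, nor the invariant subspaces.

  Conversely, let \<open>\<sigma>\<close> be irreducible. The space is not assumed to be finite-dimensional, but the
  symmetric group is finite, so an irreducible space has countable dimension, and Dixmier's argument
  (\<open>ex_eigenvalue_countable_dimension\<close>) yields Schur's lemma (\<open>schur_scalar\<close>): an operator that commutes
  with all \<open>\<sigma> p\<close> is a scalar. The operators \<open>\<sigma> p \<circ> \<sigma> q\<close> and \<open>\<sigma> (p \<circ> q)\<close> act alike by conjugation on
  all \<open>\<sigma> r\<close>, hence agree up to a scalar (\<open>\<sigma>_mult\<close>), and \<open>\<sigma>\<close> is a projective representation. In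
  particular \<open>\<sigma> t \<circ> \<sigma> t\<close> is a scalar for every transposition \<open>t\<close>, the same for all \<open>t\<close> because
  transpositions are conjugate. Multiplying by an inverse square root \<open>l\<close> of it gives operators
  \<open>\<tau> t = l \<cdot> \<sigma> t\<close> of square \<open>1\<close> with \<open>\<tau> s \<circ> \<tau> t = \<tau> (s \<circ> t \<circ> s) \<circ> \<tau> s\<close>.

  Such a family extends to a homomorphism \<open>\<rho>\<close> on the symmetric group. The only question is whether
  words in transpositions with equal products have equal values under \<open>\<tau>\<close>. This follows by
  induction on \<open>n\<close>: the relations bring every word into a form where at most one letter, the last,
  moves \<open>n\<close>, and that letter is determined by the product (\<open>word_value_normal_form\<close>,
  \<open>word_value_unique\<close>). Now \<open>\<rho> p\<close> is a product of operators \<open>\<tau> t\<close>, thus a scalar multiple of \<open>\<sigma> p\<close>,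
  and \<open>\<sigma> = \<chi> \<cdot> \<rho>\<close>, where the quandle relation for \<open>\<sigma>\<close> forces \<open>\<chi>\<close> to be a character.\<close>

section \<open>Homomorphisms defined on transpositions\<close>

lemma transpose_conjugate:
  assumes "bij p"
  shows "p \<circ> Transposition.transpose a b \<circ> inv' p = Transposition.transpose (p a) (p b)"
proof -
  have "Transposition.transpose (p a) (p b) \<circ> p = p \<circ> Transposition.transpose a b"
    using transpose_comp_eq[OF assms, of "p a" "p b"] assms by (simp add: bij_is_inj)
  then show ?thesis
    using assms by (metis bij_is_surj comp_assoc comp_id surj_iff)
qed

abbreviation swap :: "nat \<Rightarrow> nat \<Rightarrow> nat \<Rightarrow> nat" where
  "swap \<equiv> Transposition.transpose"

text \<open>A map \<open>\<tau>\<close> from the transpositions of \<open>{1..n}\<close> to self-maps of a set, whose values square to the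
  identity and are conjugated by each other as the transpositions are. Only the values of \<open>\<tau>\<close> at
  transpositions matter. The condition reads \<open>\<tau> s \<circ> \<tau> t = \<tau> (s \<circ> t \<circ> s) \<circ> \<tau> s\<close>.\<close>

locale transposition_system =
  fixes n :: nat and \<tau> :: "(nat \<Rightarrow> nat) \<Rightarrow> 'v \<Rightarrow> 'v"
  assumes square: "\<lbrakk>a \<in> {1..n}; b \<in> {1..n}; a \<noteq> b\<rbrakk> \<Longrightarrow> \<tau> (swap a b) \<circ> \<tau> (swap a b) = id"
    and conj: "\<lbrakk>a \<in> {1..n}; b \<in> {1..n}; a \<noteq> b; c \<in> {1..n}; d \<in> {1..n}; c \<noteq> d\<rbrakk>
      \<Longrightarrow> \<tau> (swap a b) \<circ> \<tau> (swap c d) = \<tau> (swap (swap a b c) (swap a b d)) \<circ> \<tau> (swap a b)"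
begin

text \<open>\<open>word_value m p A\<close>: some word in the transpositions of \<open>{1..m}\<close> has product \<open>p\<close>, while the product
  of the values of \<open>\<tau>\<close> at its letters is \<open>A\<close>. The relation is the graph of the homomorphism
  to be constructed, once it is shown to be single-valued.\<close>

inductive word_value :: "nat \<Rightarrow> (nat \<Rightarrow> nat) \<Rightarrow> ('v \<Rightarrow> 'v) \<Rightarrow> bool" for m where
  empty: "word_value m id id"
| snoc: "\<lbrakk>word_value m p A; a \<in> {1..m}; b \<in> {1..m}; a \<noteq> b\<rbrakk>
    \<Longrightarrow> word_value m (p \<circ> swap a b) (A \<circ> \<tau> (swap a b))"

lemma word_value_permutes: "word_value m p A \<Longrightarrow> p permutes {1..m}"
  by (induction rule: word_value.induct)
    (blast intro: permutes_id permutes_compose permutes_swap_id)+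

text \<open>The two relations allow every letter that moves \<open>Suc m\<close> to be pushed to the end of the word, and
  two such letters to be merged into one or cancelled; at most one remains.\<close>

lemma word_value_normal_form:
  assumes "word_value (Suc m) p A" "Suc m \<le> n"
  shows "word_value m p A \<or> (\<exists>a\<in>{1..m}. \<exists>q B. word_value m q B \<and>
    p = q \<circ> swap a (Suc m) \<and> A = B \<circ> \<tau> (swap a (Suc m)))"
  using assms(1)
proof (induction rule: word_value.induct)
  case empty
  then show ?case using word_value.empty by blast
next
  case (snoc p A b c)
  have *: "word_value m (p \<circ> swap b c) (A \<circ> \<tau> (swap b c)) \<or> (\<exists>a\<in>{1..m}. \<exists>q B. word_value m q B \<and>
    p \<circ> swap b c = q \<circ> swap a (Suc m) \<and> A \<circ> \<tau> (swap b c) = B \<circ> \<tau> (swap a (Suc m)))"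
    if b: "b \<in> {1..m}" and c: "c \<in> {1..Suc m}" "b \<noteq> c" for b c
    using snoc.IH
  proof (elim disjE bexE exE conjE)
    assume "word_value m p A"
    show ?thesis
    proof (cases "c = Suc m")
      case True
      then show ?thesis using \<open>word_value m p A\<close> b by blast
    next
      case False
      with c have "c \<in> {1..m}" by auto
      then show ?thesis using word_value.snoc[OF \<open>word_value m p A\<close> b _ c(2)] by blast
    qed
  next
    fix a q B
    assume a: "a \<in> {1..m}" and q: "word_value m q B"
      and p: "p = q \<circ> swap a (Suc m)" and A: "A = B \<circ> \<tau> (swap a (Suc m))"
    have n: "a \<in> {1..n}" "b \<in> {1..n}" "c \<in> {1..n}" "Suc m \<in> {1..n}"
      using a b c assms(2) by auto
    have ne: "a \<noteq> Suc m" "b \<noteq> Suc m" using a b by auto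
    show ?thesis
    proof (cases "c = Suc m")
      case False
      with c have c': "c \<in> {1..m}" by auto
      define a' where "a' = swap b c a"
      have a': "a' \<in> {1..m}" using a b c' by (auto simp: a'_def transpose_def)
      \<comment> \<open>Move the letter that involves \<open>Suc m\<close> to the right of \<open>swap b c\<close>.\<close>
      have "\<tau> (swap b c) \<circ> \<tau> (swap a' (Suc m)) = \<tau> (swap (swap b c a') (swap b c (Suc m))) \<circ> \<tau> (swap b c)"
        using conj[of b c a' "Suc m"] n a' assms(2) c(2) by auto
      also have "swap b c a' = a" by (simp add: a'_def)
      also have "swap b c (Suc m) = Suc m" using ne False by simp
      finally have "A \<circ> \<tau> (swap b c) = (B \<circ> \<tau> (swap b c)) \<circ> \<tau> (swap a' (Suc m))"
        by (simp only: A comp_assoc)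
      moreover have "p \<circ> swap b c = (q \<circ> swap b c) \<circ> swap a' (Suc m)"
        using ne False c(2) by (auto simp: p fun_eq_iff a'_def transpose_def)
      ultimately show ?thesis
        using word_value.snoc[OF q b c' c(2)] a' by blast
    next
      case cM: True
      show ?thesis
      proof (cases "b = a")
        case True
        have "p \<circ> swap b c = q" by (simp add: p True cM comp_assoc)
        moreover have "A \<circ> \<tau> (swap b c) = B"
          using square[of a "Suc m"] n ne by (simp add: A True cM comp_assoc)
        ultimately show ?thesis using q by simp
      next
        case False
        have "\<tau> (swap a (Suc m)) \<circ> \<tau> (swap b (Suc m)) = \<tau> (swap b a) \<circ> \<tau> (swap a (Suc m))"
          using conj[of a "Suc m" b "Suc m"] n ne False by simp
        then have "A \<circ> \<tau> (swap b c) = (B \<circ> \<tau> (swap b a)) \<circ> \<tau> (swap a (Suc m))"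
          by (simp only: A cM comp_assoc)
        moreover have "p \<circ> swap b c = (q \<circ> swap b a) \<circ> swap a (Suc m)"
          using ne False by (auto simp: p cM fun_eq_iff transpose_def)
        ultimately show ?thesis
          using word_value.snoc[OF q b a False] a by blast
      qed
    qed
  qed
  show ?case
  proof (cases "b = Suc m")
    case False
    with snoc.hyps have "b \<in> {1..m}" by auto
    then show ?thesis using snoc.hyps by (intro *)
  next
    case True
    with snoc.hyps have "c \<in> {1..m}" by auto
    then have "word_value m (p \<circ> swap c b) (A \<circ> \<tau> (swap c b)) \<or>
        (\<exists>a\<in>{1..m}. \<exists>q B. word_value m q B \<and> p \<circ> swap c b = q \<circ> swap a (Suc m) \<and>
          A \<circ> \<tau> (swap c b) = B \<circ> \<tau> (swap a (Suc m)))"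
      using snoc.hyps by (intro *) auto
    then show ?thesis by (simp only: transpose_commute[of b c])
  qed
qed

lemma word_value_unique:
  "\<lbrakk>word_value m p A; word_value m p B; m \<le> n\<rbrakk> \<Longrightarrow> A = B"
proof (induction m arbitrary: p A B)
  case 0
  have "C = id" if "word_value 0 p C" for C
    using that by (cases rule: word_value.cases) auto
  then show ?case using 0 by blast
next
  case (Suc m)
  have fixed: "q (Suc m) = Suc m" if "word_value m q C" for q C
    using word_value_permutes[OF that] by (auto simp: permutes_def)
  have move: "q (swap a (Suc m) a) = Suc m" "q (swap a (Suc m) (Suc m)) \<noteq> Suc m"
    if "word_value m q C" "a \<in> {1..m}" for q C a
    using fixed[OF that(1)] permutes_in_image[OF word_value_permutes[OF that(1)], of a] that(2)
    by auto
  \<comment> \<open>The permutation decides which normal form occurs: \<open>Suc m\<close> is fixed in the first,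
    and \<open>a\<close> is its preimage in the second.\<close>
  show ?case
    using word_value_normal_form[OF Suc.prems(1,3)] word_value_normal_form[OF Suc.prems(2,3)]
  proof (elim disjE bexE exE conjE)
    assume "word_value m p A" "word_value m p B"
    then show ?thesis using Suc by auto
  next
    fix a q C assume "word_value m p A" "word_value m q C" "a \<in> {1..m}" "p = q \<circ> swap a (Suc m)"
    then show ?thesis using fixed[of p A] move(2)[of q C a] by simp
  next
    fix a q C assume "word_value m p B" "word_value m q C" "a \<in> {1..m}" "p = q \<circ> swap a (Suc m)"
    then show ?thesis using fixed[of p B] move(2)[of q C a] by simp
  next
    fix a q C a' q' C'
    assume *: "a \<in> {1..m}" "word_value m q C" "p = q \<circ> swap a (Suc m)" "A = C \<circ> \<tau> (swap a (Suc m))"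
      and **: "a' \<in> {1..m}" "word_value m q' C'" "p = q' \<circ> swap a' (Suc m)" "B = C' \<circ> \<tau> (swap a' (Suc m))"
    have "p a = Suc m" using move(1)[OF *(2,1)] by (simp only: *(3) comp_apply)
    moreover have "p a' = Suc m" using move(1)[OF **(2,1)] by (simp only: **(3) comp_apply)
    moreover have "inj p"
      using permutes_inj[OF word_value_permutes[OF Suc.prems(1)]] .
    ultimately have a: "a' = a" by (simp add: inj_def)
    have "q = p \<circ> swap a (Suc m)"
      by (simp only: *(3) comp_assoc transpose_comp_involutory comp_id)
    moreover have "q' = p \<circ> swap a (Suc m)"
      by (simp only: **(3) a comp_assoc transpose_comp_involutory comp_id)
    ultimately have "C = C'" using Suc.IH[of q C C'] * ** Suc.prems(3) by auto
    then show ?thesis using * ** a by simp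
  qed
qed

lemma word_value_comp:
  "\<lbrakk>word_value m q B; word_value m p A\<rbrakk> \<Longrightarrow> word_value m (p \<circ> q) (A \<circ> B)"
  by (induction arbitrary: p A rule: word_value.induct)
    (auto simp: o_assoc intro: word_value.snoc)

lemma word_value_exists:
  assumes "p permutes {1..m}" shows "\<exists>A. word_value m p A"
  using finite_atLeastAtMost assms
  by (induction rule: permutes_rev_induct) (blast intro: word_value.intros)+

text \<open>The extension of \<open>\<tau>\<close> to a homomorphism on the symmetric group; it is meaningful only on
  permutations of \<open>{1..n}\<close>.\<close>

definition extension :: "(nat \<Rightarrow> nat) \<Rightarrow> 'v \<Rightarrow> 'v" where
  "extension p = (THE A. word_value n p A)"

lemma extension_eq: "word_value n p A \<Longrightarrow> extension p = A"
  unfolding extension_def using word_value_unique by blast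

lemma word_value_extension: "p permutes {1..n} \<Longrightarrow> word_value n p (extension p)"
  using word_value_exists extension_eq by metis

lemma extension_comp:
  "\<lbrakk>p permutes {1..n}; q permutes {1..n}\<rbrakk> \<Longrightarrow> extension (p \<circ> q) = extension p \<circ> extension q"
  by (intro extension_eq word_value_comp word_value_extension)

end

section \<open>Schur's lemma in countable dimension\<close>

text \<open>A countably generated space is the union of countably many finitely generated subspaces, and one of
  these must contain infinitely many members of any uncountable family.\<close>

lemma (in vector_space) ex_finite_infinite_vimage:
  assumes "countable S" "span S = UNIV" "uncountable (UNIV :: 'i set)"
  obtains T where "finite T" "infinite {i :: 'i. u i \<in> span T}"
proof -
  obtain s where s: "S \<subseteq> range (s :: nat \<Rightarrow> 'b)"
    using assms(1) range_from_nat_into[of S] by (metis empty_subsetI order_refl)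
  have "\<exists>k. u i \<in> span (s ` {..<k})" for i
  proof -
    have "u i \<in> span S" using assms(2) by simp
    then obtain T r where T: "finite T" "T \<subseteq> S" and "u i = (\<Sum>b\<in>T. scale (r b) b)"
      unfolding span_explicit by blast
    then have uT: "u i \<in> span T" by (simp add: span_sum span_scale span_base)
    obtain N where N: "finite N" "T = s ` N"
      using finite_subset_image[OF T(1), of s UNIV] T(2) s by blast
    then obtain k where "N \<subseteq> {..<k}" by (meson finite_nat_iff_bounded)
    then show ?thesis using uT N span_mono[of T "s ` {..<k}"] by blast
  qed
  then have "(UNIV :: 'i set) = (\<Union>k. {i. u i \<in> span (s ` {..<k})})" by auto
  then have "\<exists>k. uncountable {i. u i \<in> span (s ` {..<k})}"
    using assms(3) by (metis countable_UN countableI_type)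
  then obtain k where "uncountable {i. u i \<in> span (s ` {..<k})}" ..
  then show thesis using that[of "s ` {..<k}"] countable_finite by blast
qed

text \<open>A linear operator \<open>z\<close> on a complex vector space of arbitrary dimension.\<close>

locale complex_operator = vector_space scale
  for scale :: "complex \<Rightarrow> 'v::ab_group_add \<Rightarrow> 'v" +
  fixes z :: "'v \<Rightarrow> 'v"
  assumes z_add: "z (v + w) = z v + z w" and z_scale: "z (scale c v) = scale c (z v)"
begin

lemma z_0: "z 0 = 0"
  using z_add[of 0 0] by simp

text \<open>\<open>poly_act p v\<close> is \<open>p(z) v\<close>, computed by the Horner scheme.\<close>

definition poly_act :: "complex poly \<Rightarrow> 'v \<Rightarrow> 'v" where
  "poly_act p v = fold_coeffs (\<lambda>a w. scale a v + z w) p 0"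

lemma poly_act_0 [simp]: "poly_act 0 v = 0"
  by (simp add: poly_act_def)

lemma poly_act_pCons [simp]: "poly_act (pCons a p) v = scale a v + z (poly_act p v)"
  by (cases "a = 0 \<and> p = 0") (auto simp: poly_act_def z_0)

lemma poly_act_add: "poly_act (p + q) v = poly_act p v + poly_act q v"
  by (induction p q rule: poly_induct2) (simp_all add: z_add algebra_simps)

lemma poly_act_smult: "poly_act (smult c p) v = scale c (poly_act p v)"
  by (induction p) (simp_all add: z_scale algebra_simps)

lemma poly_act_sum: "poly_act (\<Sum>i\<in>F. f i) v = (\<Sum>i\<in>F. poly_act (f i) v)"
  by (induction F rule: infinite_finite_induct) (simp_all add: poly_act_add)

lemma poly_act_vector_add: "poly_act p (v + w) = poly_act p v + poly_act p w"
  by (induction p) (simp_all add: z_add algebra_simps)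

lemma poly_act_vector_scale: "poly_act p (scale c v) = scale c (poly_act p v)"
  by (induction p) (simp_all add: z_scale algebra_simps)

lemma poly_act_vector_0: "poly_act p 0 = 0"
  using poly_act_vector_scale[of p 0 0] by simp

lemma poly_act_vector_sum: "poly_act p (\<Sum>i\<in>F. f i) = (\<Sum>i\<in>F. poly_act p (f i))"
  by (induction F rule: infinite_finite_induct) (simp_all add: poly_act_vector_add poly_act_vector_0)

lemma poly_act_commute: "poly_act p (z v) = z (poly_act p v)"
  by (induction p) (simp_all add: z_add z_scale z_0)

lemma poly_act_linear_mult:
  "poly_act ([:- l, 1:] * q) v = poly_act q (z v - scale l v)"
proof -
  have "poly_act ([:- l, 1:] * q) v = z (poly_act q v) - scale l (poly_act q v)"
    by (simp add: mult_pCons_left poly_act_add poly_act_smult del: smult_minus_left add_uminus_conv_diff)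
  also have "\<dots> = poly_act q (z v) + poly_act q (scale (- l) v)"
    by (simp only: poly_act_commute poly_act_vector_scale) simp
  also have "\<dots> = poly_act q (z v - scale l v)"
    by (simp flip: poly_act_vector_add)
  finally show ?thesis .
qed

lemma poly_act_injective:
  assumes inj: "\<And>l w. z w - scale l w = 0 \<Longrightarrow> w = 0"
  shows "p \<noteq> 0 \<Longrightarrow> poly_act p v = 0 \<Longrightarrow> v = 0"
  \<comment> \<open>Over the complex numbers \<open>p\<close> splits into linear factors, each acting injectively.\<close>
proof (induction "degree p" arbitrary: p v)
  case 0
  then obtain a where "p = [:a:]" "a \<noteq> 0" by (metis degree_eq_zeroE pCons_eq_0_iff)
  then show ?case using 0 by (simp add: z_0)
next
  case (Suc k)
  then have "\<not> constant (poly p)" by (simp add: constant_degree)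
  then obtain l where "poly p l = 0" using fundamental_theorem_of_algebra by blast
  then obtain q where q: "p = [:- l, 1:] * q" by (auto simp: poly_eq_0_iff_dvd)
  then have "q \<noteq> 0" using Suc.prems by auto
  then have "degree q = k" using Suc.hyps(2) q degree_mult_eq[of "[:- l, 1:]" q] by simp
  then have "z v - scale l v = 0"
    using Suc.hyps(1)[of q] \<open>q \<noteq> 0\<close> Suc.prems(2) q poly_act_linear_mult by metis
  then show ?case by (rule inj)
qed

text \<open>The vectors \<open>u l = (z - l)\<^sup>-\<^sup>1 v\<close> are linearly independent: clearing denominators in a relation
  \<open>\<Sum> c\<^sub>i u\<^sub>i = 0\<close> gives \<open>p(z) v = 0\<close>, where \<open>p = \<Sum> c\<^sub>i \<Prod>\<^bsub>j \<noteq> i\<^esub> (X - j)\<close> does not vanish at \<open>i\<close>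
  if \<open>c\<^sub>i \<noteq> 0\<close>.\<close>

lemma resolvents_independent:
  assumes inj: "\<And>l w. z w - scale l w = 0 \<Longrightarrow> w = 0"
    and u: "\<And>l. z (u l) - scale l (u l) = v" and "v \<noteq> 0"
  shows "inj u" "independent (range u)"
proof -
  show "inj u"
  proof (rule injI)
    fix l m assume eq: "u l = u m"
    have "scale l (u l) = scale m (u l)" using u[of l] u[of m] eq
      by (metis add_diff_cancel_left' diff_add_cancel diff_diff_eq2)
    moreover have "u l \<noteq> 0" using u[of l] \<open>v \<noteq> 0\<close> z_0 by auto
    ultimately show "l = m" by (simp add: scale_right_imp_eq)
  qed
  have coeffs: "c i = 0" if F: "finite F" and sum: "(\<Sum>i\<in>F. scale (c i) (u i)) = 0" and i: "i \<in> F" for F c i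
  proof (rule ccontr)
    assume "c i \<noteq> 0"
    define P where "P = (\<lambda>G. \<Prod>j\<in>G. [:- j, 1:] :: complex poly)"
    define p where "p = (\<Sum>j\<in>F. smult (c j) (P (F - {j})))"
    have P: "poly_act (P F) (u j) = poly_act (P (F - {j})) v" if "j \<in> F" for j
    proof -
      have "P F = [:- j, 1:] * P (F - {j})" unfolding P_def using F that by (rule prod.remove)
      then show ?thesis by (simp only: poly_act_linear_mult u)
    qed
    have "poly_act p v = (\<Sum>j\<in>F. scale (c j) (poly_act (P F) (u j)))"
      by (simp add: p_def poly_act_sum poly_act_smult P)
    also have "\<dots> = poly_act (P F) (\<Sum>j\<in>F. scale (c j) (u j))"
      by (simp add: poly_act_vector_sum poly_act_vector_scale)
    finally have "poly_act p v = 0" by (simp add: sum poly_act_vector_0)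
    moreover have "poly p i \<noteq> 0"
    proof -
      have "poly (P (F - {j})) i = 0" if "j \<in> F" "j \<noteq> i" for j
        using that F i by (auto simp: P_def poly_prod)
      then have "poly p i = c i * poly (P (F - {i})) i"
        using F i by (simp add: p_def poly_sum sum.remove)
      also have "\<dots> \<noteq> 0" using F \<open>c i \<noteq> 0\<close> by (auto simp: P_def poly_prod)
      finally show ?thesis .
    qed
    then have "p \<noteq> 0" by auto
    ultimately show False using poly_act_injective[of p v] inj \<open>v \<noteq> 0\<close> by blast
  qed
  show "independent (range u)"
    unfolding independent_explicit_finite_subsets
  proof (intro allI impI ballI)
    fix S d w assume S: "S \<subseteq> range u" "finite S" and sum: "(\<Sum>w\<in>S. scale (d w) w) = 0" and w: "w \<in> S"
    obtain F where F: "finite F" "S = u ` F" using S by (metis finite_subset_image)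
    have "inj_on u F" using \<open>inj u\<close> by (rule inj_on_subset) simp
    then show "d w = 0" using coeffs[of F "\<lambda>i. d (u i)"] sum w F by (auto simp: sum.reindex)
  qed
qed

text \<open>Dixmier's argument: if every \<open>z - l\<close> were invertible, the uncountably many vectors
  \<open>(z - l)\<^sup>-\<^sup>1 v\<close> would be independent in a space of countable dimension.\<close>

lemma ex_eigenvalue_countable_dimension:
  assumes "countable S" "span S = UNIV" "(UNIV :: 'v set) \<noteq> {0}"
  shows "\<exists>l. \<not> bij (\<lambda>w. z w - scale l w)"
proof (rule ccontr)
  assume "\<not> ?thesis"
  then have bij: "bij (\<lambda>w. z w - scale l w)" for l by blast
  have inj: "w = 0" if "z w - scale l w = 0" for l w
    using injD[OF bij_is_inj[OF bij[of l]], of w 0] that z_0 by simp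
  obtain v :: 'v where "v \<noteq> 0" using assms(3) by blast
  have "\<exists>w. z w - scale l w = v" for l
    using surjD[OF bij_is_surj[OF bij[of l]], of v] by (auto intro: sym)
  then obtain u where u: "\<And>l. z (u l) - scale l (u l) = v"
    using choice[of "\<lambda>l w. z w - scale l w = v"] by blast
  have ind: "inj u" "independent (range u)"
    using resolvents_independent[of u v] inj u \<open>v \<noteq> 0\<close> by blast+
  from ex_finite_infinite_vimage[OF assms(1,2) uncountable_UNIV_complex, of u] obtain T
    where T: "finite T" "infinite {l. u l \<in> span T}" by blast
  let ?U = "u ` {l. u l \<in> span T}"
  have "independent ?U" using ind(2) by (rule independent_mono) auto
  then have "finite ?U" using independent_span_bound[OF T(1)] by blast
  then show False using T(2) ind(1) by (auto dest!: finite_imageD intro: inj_on_subset)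
qed

text \<open>Schur's lemma for a countable irreducible family of operators. The orbit of a nonzero vector
  under words in the family spans, so that the dimension is countable; for an eigenvalue \<open>l\<close> in the
  sense that \<open>z - l\<close> is not bijective, the kernel and the range of \<open>z - l\<close> are invariant, which forces
  \<open>z = l\<close>.\<close>

lemma schur_scalar:
  assumes irr: "irreducible_action scale X \<sigma>" and "countable X"
    and \<sigma>: "\<And>x. x \<in> X \<Longrightarrow> Vector_Spaces.linear scale scale (\<sigma> x)"
    and commute: "\<And>x v. x \<in> X \<Longrightarrow> z (\<sigma> x v) = \<sigma> x (z v)"
  obtains l where "\<And>v. z v = scale l v"
proof -
  have nontriv: "(UNIV :: 'v set) \<noteq> {0}"
    and irrD: "\<And>W. subspace W \<Longrightarrow> (\<And>x w. x \<in> X \<Longrightarrow> w \<in> W \<Longrightarrow> \<sigma> x w \<in> W) \<Longrightarrow> W = {0} \<or> W = UNIV"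
    using irr by (auto simp: irreducible_action_def subrep_def image_subset_iff)
  have \<sigma>_simps: "\<sigma> x (v + w) = \<sigma> x v + \<sigma> x w" "\<sigma> x (v - w) = \<sigma> x v - \<sigma> x w"
      "\<sigma> x (scale c v) = scale c (\<sigma> x v)" "\<sigma> x 0 = 0"
    if "x \<in> X" for x v w c
  proof -
    interpret Vector_Spaces.linear scale scale "\<sigma> x" by (rule \<sigma>[OF that])
    show "\<sigma> x (v + w) = \<sigma> x v + \<sigma> x w" "\<sigma> x (v - w) = \<sigma> x v - \<sigma> x w"
      "\<sigma> x (scale c v) = scale c (\<sigma> x v)" "\<sigma> x 0 = 0"
      by (simp_all add: add diff scale)
  qed
  obtain v :: 'v where "v \<noteq> 0" using nontriv by blast
  define S where "S = (\<lambda>xs. foldr \<sigma> xs v) ` lists X"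
  have "countable S" unfolding S_def using \<open>countable X\<close> by blast
  have "v \<in> S" unfolding S_def by (rule image_eqI[of _ _ "[]"]) auto
  have S: "\<sigma> x w \<in> S" if x: "x \<in> X" and w: "w \<in> S" for x w
  proof -
    from w obtain xs where "xs \<in> lists X" "w = foldr \<sigma> xs v" unfolding S_def by blast
    then show ?thesis unfolding S_def using x by (intro image_eqI[of _ _ "x # xs"]) auto
  qed
  have "span S = {0} \<or> span S = UNIV"
  proof (rule irrD)
    fix x w assume x: "x \<in> X" and "w \<in> span S"
    from this(2) show "\<sigma> x w \<in> span S"
      by (induction rule: span_induct_alt)
        (simp_all add: \<sigma>_simps[OF x] span_zero span_add span_scale span_base S x)
  qed simp
  moreover have "v \<in> span S" using \<open>v \<in> S\<close> by (rule span_base)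
  ultimately have "span S = UNIV" using \<open>v \<noteq> 0\<close> by auto
  then obtain l where l: "\<not> bij (\<lambda>w. z w - scale l w)"
    using ex_eigenvalue_countable_dimension[OF \<open>countable S\<close> _ nontriv] by blast
  define D where "D = (\<lambda>w. z w - scale l w)"
  have D_add: "D (v + w) = D v + D w" and D_scale: "D (scale c v) = scale c (D v)" for v w c
    by (simp_all add: D_def z_add z_scale algebra_simps)
  have D_\<sigma>: "D (\<sigma> x w) = \<sigma> x (D w)" if "x \<in> X" for x w
    using that by (simp add: D_def commute \<sigma>_simps)
  have D_0: "D 0 = 0" by (simp add: D_def z_0)
  have ker: "{w. D w = 0} = {0} \<or> {w. D w = 0} = UNIV"
  proof (rule irrD)
    show "subspace {w. D w = 0}"
      by (simp add: subspace_def D_add D_scale D_0)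
    show "\<sigma> x w \<in> {w. D w = 0}" if "x \<in> X" "w \<in> {w. D w = 0}" for x w
      using that D_\<sigma>[of x w] \<sigma>_simps by simp
  qed
  have ran: "range D = {0} \<or> range D = UNIV"
  proof (rule irrD)
    show "subspace (range D)"
      unfolding subspace_def
      using rangeI[of D 0] by (auto simp: D_0 simp flip: D_add D_scale)
    show "\<sigma> x w \<in> range D" if "x \<in> X" "w \<in> range D" for x w
      using that by (auto simp flip: D_\<sigma>)
  qed
  have "D w = 0" for w
  proof (rule ccontr)
    assume w: "D w \<noteq> 0"
    have "inj D"
    proof (rule injI)
      fix a b assume "D a = D b"
      then have "D (a - b) = 0" using D_add[of a "- b"] D_scale[of "-1" b] by simp
      moreover have "{w. D w = 0} = {0}" using ker w by blast
      ultimately have "a - b = 0" by blast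
      then show "a = b" by simp
    qed
    moreover have "range D = UNIV" using ran w by blast
    ultimately show False using l by (simp add: bij_def D_def)
  qed
  then show thesis using that[of l] by (simp add: D_def)
qed

end

section \<open>Quandle representations of conjugation quandles\<close>

lemma irreducible_action_twist:
  assumes "vector_space scale" and "\<And>x. x \<in> X \<Longrightarrow> \<chi> x \<noteq> 0" and "\<And>x. x \<in> X \<Longrightarrow> \<sigma> x = twist scale \<chi> \<rho> x"
  shows "irreducible_action scale X \<sigma> \<longleftrightarrow> irreducible_action scale X \<rho>"
proof -
  interpret vector_space scale by fact
  have "subrep scale X \<sigma> W \<longleftrightarrow> subrep scale X \<rho> W" for W
  proof -
    have "scale (\<chi> x) u \<in> W \<longleftrightarrow> u \<in> W" if "subspace W" "x \<in> X" for x u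
      using subspace_scale[OF that(1), of u "\<chi> x"] subspace_scale[OF that(1), of "scale (\<chi> x) u" "inverse (\<chi> x)"]
        assms(2)[OF that(2)] by auto
    then show ?thesis
      using assms(3) by (auto simp: subrep_def image_subset_iff twist_def)
  qed
  then show ?thesis by (simp add: irreducible_action_def)
qed

lemma quandle_rep_Conj_iff:
  assumes G: "group G" and "vector_space scale"
  shows "quandle_rep (Conj G) scale \<rho> \<longleftrightarrow>
    (\<forall>x\<in>carrier G. Vector_Spaces.linear scale scale (\<rho> x) \<and> bij (\<rho> x)) \<and>
    (\<forall>x\<in>carrier G. \<forall>y\<in>carrier G. \<rho> (x \<otimes>\<^bsub>G\<^esub> y \<otimes>\<^bsub>G\<^esub> inv\<^bsub>G\<^esub> x) \<circ> \<rho> x = \<rho> x \<circ> \<rho> y)"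
proof -
  interpret G: group G by fact
  interpret GL: group "GL scale" using vector_space.group_GL[OF assms(2)] .
  have "\<rho> (x \<otimes>\<^bsub>G\<^esub> y \<otimes>\<^bsub>G\<^esub> inv\<^bsub>G\<^esub> x) = \<rho> x \<otimes>\<^bsub>GL scale\<^esub> \<rho> y \<otimes>\<^bsub>GL scale\<^esub> inv\<^bsub>GL scale\<^esub> \<rho> x
    \<longleftrightarrow> \<rho> (x \<otimes>\<^bsub>G\<^esub> y \<otimes>\<^bsub>G\<^esub> inv\<^bsub>G\<^esub> x) \<circ> \<rho> x = \<rho> x \<circ> \<rho> y"
    if "x \<in> carrier G" "y \<in> carrier G" "\<rho> \<in> carrier G \<rightarrow> carrier (GL scale)" for x y
  proof -
    have "\<rho> x \<in> carrier (GL scale)" "\<rho> y \<in> carrier (GL scale)"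
      "\<rho> (x \<otimes>\<^bsub>G\<^esub> y \<otimes>\<^bsub>G\<^esub> inv\<^bsub>G\<^esub> x) \<in> carrier (GL scale)"
      using that by auto
    from GL.inv_solve_right[OF this(3) GL.m_closed[OF this(1,2)] this(1)]
    show ?thesis by (auto simp: GL_def)
  qed
  then show ?thesis
    using assms(2) G.quandle_Conj by (auto simp: quandle_rep_def GL_def)
qed

section \<open>Irreducible representations of the conjugation quandle of a symmetric group\<close>

text \<open>The hypothesis on \<open>\<sigma>\<close> is that of an irreducible quandle representation of the conjugation quandle
  of the symmetric group, written without inverses of operators.\<close>

locale irreducible_conj_rep = vector_space scale
  for scale :: "complex \<Rightarrow> 'v::ab_group_add \<Rightarrow> 'v" +
  fixes n :: nat and \<sigma> :: "(nat \<Rightarrow> nat) \<Rightarrow> 'v \<Rightarrow> 'v"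
  assumes irr: "irreducible_action scale {p. p permutes {1..n}} \<sigma>"
    and linear_\<sigma>: "p permutes {1..n} \<Longrightarrow> Vector_Spaces.linear scale scale (\<sigma> p)"
    and bij_\<sigma>: "p permutes {1..n} \<Longrightarrow> bij (\<sigma> p)"
    and conj_\<sigma>: "\<lbrakk>p permutes {1..n}; q permutes {1..n}\<rbrakk>
      \<Longrightarrow> \<sigma> (p \<circ> q \<circ> inv' p) (\<sigma> p v) = \<sigma> p (\<sigma> q v)"
begin

lemma nontrivial: obtains v :: 'v where "v \<noteq> 0"
  using irr by (auto simp: irreducible_action_def)

lemma \<sigma>_add: "p permutes {1..n} \<Longrightarrow> \<sigma> p (v + w) = \<sigma> p v + \<sigma> p w"
  and \<sigma>_scale: "p permutes {1..n} \<Longrightarrow> \<sigma> p (scale c v) = scale c (\<sigma> p v)"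
  using linear_\<sigma> by (auto simp: Vector_Spaces.linear_iff)

lemma \<sigma>_0: "p permutes {1..n} \<Longrightarrow> \<sigma> p 0 = 0"
  using \<sigma>_scale[of p 0 0] by simp

lemma \<sigma>_cancel: "p permutes {1..n} \<Longrightarrow> \<sigma> p v = \<sigma> p w \<longleftrightarrow> v = w"
  using bij_\<sigma> by (metis bij_is_inj injD)

lemma commuting_scalar:
  assumes "\<And>v w. z (v + w) = z v + z w" "\<And>c v. z (scale c v) = scale c (z v)" "inj z"
    and "\<And>p v. p permutes {1..n} \<Longrightarrow> z (\<sigma> p v) = \<sigma> p (z v)"
  obtains c where "c \<noteq> 0" "\<And>v. z v = scale c v"
proof -
  interpret complex_operator scale z using assms(1,2) by unfold_locales
  have "countable {p. p permutes {1..n}}"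
    using finite_permutations[of "{1..n}"] by (simp add: countable_finite)
  then obtain c where c: "\<And>v. z v = scale c v"
    using schur_scalar[OF irr] linear_\<sigma> assms(4) by (metis mem_Collect_eq)
  moreover have "c \<noteq> 0"
    using nontrivial c injD[OF assms(3)] by (metis scale_zero_left)
  ultimately show thesis using that by blast
qed

text \<open>Both \<open>\<sigma> p \<circ> \<sigma> q\<close> and \<open>\<sigma> (p \<circ> q)\<close> conjugate every \<open>\<sigma> r\<close> to \<open>\<sigma> (p q r q\<^sup>-\<^sup>1 p\<^sup>-\<^sup>1)\<close>, so their quotient
  commutes with the representation. Hence \<open>\<sigma>\<close> is a projective representation of the group.\<close>

lemma \<sigma>_mult:
  assumes p: "p permutes {1..n}" and q: "q permutes {1..n}"
  obtains c where "c \<noteq> 0" "\<And>v. \<sigma> p (\<sigma> q v) = scale c (\<sigma> (p \<circ> q) v)"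
proof -
  have pq: "(p \<circ> q) permutes {1..n}" using q p by (rule permutes_compose)
  define z where "z v = inv' (\<sigma> (p \<circ> q)) (\<sigma> p (\<sigma> q v))" for v
  have z: "\<sigma> (p \<circ> q) (z v) = \<sigma> p (\<sigma> q v)" for v
    unfolding z_def by (simp add: bij_\<sigma>[OF pq] bij_is_surj surj_f_inv_f)
  have "z (\<sigma> r v) = \<sigma> r (z v)" if r: "r permutes {1..n}" for r v
  proof -
    have qr: "(q \<circ> r \<circ> inv' q) permutes {1..n}" using q r by (intro permutes_compose permutes_inv)
    have "\<sigma> (p \<circ> q) (z (\<sigma> r v)) = \<sigma> p (\<sigma> (q \<circ> r \<circ> inv' q) (\<sigma> q v))"
      by (simp only: z conj_\<sigma>[OF q r])
    also have "\<dots> = \<sigma> (p \<circ> (q \<circ> r \<circ> inv' q) \<circ> inv' p) (\<sigma> p (\<sigma> q v))"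
      by (simp only: conj_\<sigma>[OF p qr])
    also have "p \<circ> (q \<circ> r \<circ> inv' q) \<circ> inv' p = (p \<circ> q) \<circ> r \<circ> inv' (p \<circ> q)"
      by (simp only: o_inv_distrib[OF permutes_bij[OF p] permutes_bij[OF q]] o_assoc)
    also have "\<sigma> \<dots> (\<sigma> p (\<sigma> q v)) = \<sigma> (p \<circ> q) (\<sigma> r (z v))"
      by (simp only: conj_\<sigma>[OF pq r] flip: z)
    finally show ?thesis by (simp only: \<sigma>_cancel[OF pq])
  qed
  moreover have "z (v + w) = z v + z w" for v w
    by (subst \<sigma>_cancel[OF pq, symmetric]) (simp add: z \<sigma>_add[OF p] \<sigma>_add[OF q] \<sigma>_add[OF pq])
  moreover have "z (scale c v) = scale c (z v)" for c v
    by (subst \<sigma>_cancel[OF pq, symmetric]) (simp add: z \<sigma>_scale[OF p] \<sigma>_scale[OF q] \<sigma>_scale[OF pq])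
  moreover have "inj z"
    using z \<sigma>_cancel p q by (intro injI) metis
  ultimately obtain c where c: "c \<noteq> 0" "\<And>v. z v = scale c v" using commuting_scalar by metis
  then have "\<sigma> p (\<sigma> q v) = scale c (\<sigma> (p \<circ> q) v)" for v
    using z[of v] by (simp add: \<sigma>_scale[OF pq])
  with c(1) show thesis by (rule that)
qed

lemma \<sigma>_id: obtains c where "c \<noteq> 0" "\<And>v. \<sigma> id v = scale c v"
proof -
  have "\<sigma> id (\<sigma> p v) = \<sigma> p (\<sigma> id v)" if p: "p permutes {1..n}" for p v
    using conj_\<sigma>[OF permutes_id p, of v] by simp
  then show thesis
    using commuting_scalar[of "\<sigma> id"] \<sigma>_add[OF permutes_id] \<sigma>_scale[OF permutes_id]
      bij_is_inj[OF bij_\<sigma>[OF permutes_id]] that by blast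
qed

lemma \<sigma>_involution:
  assumes p: "p permutes {1..n}" and "p \<circ> p = id"
  obtains c where "c \<noteq> 0" "\<And>v. \<sigma> p (\<sigma> p v) = scale c v"
proof -
  obtain c where c: "c \<noteq> 0" "\<And>v. \<sigma> p (\<sigma> p v) = scale c (\<sigma> id v)"
    using \<sigma>_mult[OF p p] assms(2) by metis
  obtain d where d: "d \<noteq> 0" "\<And>v. \<sigma> id v = scale d v" using \<sigma>_id by metis
  show thesis using that[of "c * d"] c d by simp
qed

text \<open>All transpositions are conjugate, so the scalar \<open>\<sigma> t \<circ> \<sigma> t\<close> does not depend on the transposition
  \<open>t\<close>, and one factor \<open>l\<close> normalises all of them.\<close>

lemma \<sigma>_swap_square:
  obtains l where "l \<noteq> 0"
    "\<And>a b v. \<lbrakk>a \<in> {1..n}; b \<in> {1..n}; a \<noteq> b\<rbrakk>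
      \<Longrightarrow> scale (l * l) (\<sigma> (swap a b) (\<sigma> (swap a b) v)) = v"
proof (cases "\<exists>a b. a \<in> {1..n} \<and> b \<in> {1..n} \<and> a \<noteq> b")
  \<comment> \<open>For \<open>n \<le> 1\<close> there are no transpositions.\<close>
  case False
  then show thesis using that[of 1] by auto
next
  case True
  then obtain a b where ab: "a \<in> {1..n}" "b \<in> {1..n}" "a \<noteq> b" by blast
  have s: "swap a b permutes {1..n}" using ab by (intro permutes_swap_id)
  then obtain c where c: "c \<noteq> 0" "\<And>v. \<sigma> (swap a b) (\<sigma> (swap a b) v) = scale c v"
    using \<sigma>_involution[of "swap a b"] by auto
  have all: "\<sigma> (swap a' b') (\<sigma> (swap a' b') v) = scale c v"
    if ab': "a' \<in> {1..n}" "b' \<in> {1..n}" "a' \<noteq> b'" for a' b' v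
  proof -
    \<comment> \<open>\<open>g\<close> maps \<open>a\<close> to \<open>a'\<close> and \<open>b\<close> to \<open>b'\<close>.\<close>
    define g where "g = swap (swap a a' b) b' \<circ> swap a a'"
    have "swap a a' b \<in> {1..n}" using ab ab' by (auto simp: transpose_def)
    then have g: "g permutes {1..n}"
      unfolding g_def using ab ab' by (intro permutes_compose permutes_swap_id)
    have "g a = a'" "g b = b'" using ab ab' by (auto simp: g_def transpose_def)
    then have t: "\<sigma> (swap a' b') (\<sigma> g v) = \<sigma> g (\<sigma> (swap a b) v)" for v
      using conj_\<sigma>[OF g s, of v] transpose_conjugate[OF permutes_bij[OF g], of a b] by simp
    obtain w where w: "v = \<sigma> g w" using bij_\<sigma>[OF g] by (metis bij_pointE)
    show ?thesis by (simp add: w t c \<sigma>_scale[OF g])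
  qed
  have "csqrt c * csqrt c = c" by (simp flip: power2_eq_square)
  then have "(inverse (csqrt c) * inverse (csqrt c)) * c = 1"
    using c(1) by (simp flip: inverse_mult_distrib)
  then show thesis using that[of "inverse (csqrt c)"] c(1) all by simp
qed

text \<open>The normalised operators \<open>l \<cdot> \<sigma> t\<close> extend to a homomorphism \<open>\<rho>\<close>. As each \<open>\<rho> p\<close> is a product of
  such operators, it is a scalar multiple of \<open>\<sigma> p\<close>; the quandle relation makes the scalar a class
  function.\<close>

lemma ex_twist:
  obtains \<chi> \<rho> where
    "\<And>p. p permutes {1..n} \<Longrightarrow> \<chi> p \<noteq> 0"
    "\<And>p q. \<lbrakk>p permutes {1..n}; q permutes {1..n}\<rbrakk> \<Longrightarrow> \<chi> (p \<circ> q \<circ> inv' p) = \<chi> q"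
    "\<And>p. p permutes {1..n} \<Longrightarrow> Vector_Spaces.linear scale scale (\<rho> p) \<and> bij (\<rho> p)"
    "\<And>p q. \<lbrakk>p permutes {1..n}; q permutes {1..n}\<rbrakk> \<Longrightarrow> \<rho> (p \<circ> q) = \<rho> p \<circ> \<rho> q"
    "\<And>p. p permutes {1..n} \<Longrightarrow> \<sigma> p = twist scale \<chi> \<rho> p"
proof -
  obtain l where l: "l \<noteq> 0" and square: "\<And>a b v. \<lbrakk>a \<in> {1..n}; b \<in> {1..n}; a \<noteq> b\<rbrakk>
      \<Longrightarrow> scale (l * l) (\<sigma> (swap a b) (\<sigma> (swap a b) v)) = v"
    using \<sigma>_swap_square by metis
  define \<tau> where "\<tau> p v = scale l (\<sigma> p v)" for p v
  interpret \<tau>: transposition_system n \<tau>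
  proof
    fix a b assume ab: "a \<in> {1..n}" "b \<in> {1..n}" "a \<noteq> b"
    then have s: "swap a b permutes {1..n}" by (intro permutes_swap_id)
    show "\<tau> (swap a b) \<circ> \<tau> (swap a b) = id"
      using square[OF ab] by (simp add: fun_eq_iff \<tau>_def \<sigma>_scale[OF s])
    fix c d assume cd: "c \<in> {1..n}" "d \<in> {1..n}" "c \<noteq> d"
    then have t: "swap c d permutes {1..n}" by (intro permutes_swap_id)
    have u: "swap (swap a b c) (swap a b d) permutes {1..n}"
      using ab cd by (intro permutes_swap_id) (auto simp: transpose_def)
    show "\<tau> (swap a b) \<circ> \<tau> (swap c d) = \<tau> (swap (swap a b c) (swap a b d)) \<circ> \<tau> (swap a b)"
      using conj_\<sigma>[OF s t, unfolded transpose_conjugate[OF permutes_bij[OF s]]]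
      by (simp add: fun_eq_iff \<tau>_def \<sigma>_scale[OF s] \<sigma>_scale[OF u])
  qed
  have scalar: "\<exists>c. c \<noteq> 0 \<and> (\<forall>v. A v = scale c (\<sigma> p v))" if "\<tau>.word_value n p A" for p A
    using that
  proof (induction rule: \<tau>.word_value.induct)
    case empty
    obtain c where c: "c \<noteq> 0" "\<And>v. \<sigma> id v = scale c v" using \<sigma>_id by metis
    have "id v = scale (inverse c) (\<sigma> id v)" for v by (simp add: c)
    then show ?case using c(1) nonzero_imp_inverse_nonzero by blast
  next
    case (snoc p A a b)
    then obtain c where c: "c \<noteq> 0" "\<And>v. A v = scale c (\<sigma> p v)" by blast
    have p: "p permutes {1..n}" using snoc.hyps(1) by (rule \<tau>.word_value_permutes)
    have s: "swap a b permutes {1..n}" using snoc.hyps by (intro permutes_swap_id)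
    obtain d where d: "d \<noteq> 0" "\<And>v. \<sigma> p (\<sigma> (swap a b) v) = scale d (\<sigma> (p \<circ> swap a b) v)"
      using \<sigma>_mult[OF p s] by metis
    have "(A \<circ> \<tau> (swap a b)) v = scale (c * l * d) (\<sigma> (p \<circ> swap a b) v)" for v
      by (simp add: c d \<tau>_def \<sigma>_scale[OF p] mult.assoc)
    moreover have "c * l * d \<noteq> 0" using c(1) d(1) l by simp
    ultimately show ?case by blast
  qed
  define \<rho> where "\<rho> = \<tau>.extension"
  have "\<exists>c. c \<noteq> 0 \<and> (\<forall>v. \<rho> p v = scale c (\<sigma> p v))" if "p permutes {1..n}" for p
    unfolding \<rho>_def by (rule scalar[OF \<tau>.word_value_extension[OF that]])
  then obtain c where c: "\<And>p. p permutes {1..n} \<Longrightarrow> c p \<noteq> 0"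
    "\<And>p v. p permutes {1..n} \<Longrightarrow> \<rho> p v = scale (c p) (\<sigma> p v)" by metis
  define \<chi> where "\<chi> p = inverse (c p)" for p
  have \<chi>: "\<chi> p \<noteq> 0" if "p permutes {1..n}" for p using c(1)[OF that] by (simp add: \<chi>_def)
  have \<sigma>: "\<sigma> p v = scale (\<chi> p) (\<rho> p v)" if "p permutes {1..n}" for p v
    using c[OF that] by (simp add: \<chi>_def)
  have hom: "\<rho> (p \<circ> q) = \<rho> p \<circ> \<rho> q" if "p permutes {1..n}" "q permutes {1..n}" for p q
    unfolding \<rho>_def using that by (rule \<tau>.extension_comp)
  have lin: "Vector_Spaces.linear scale scale (\<rho> p)" if p: "p permutes {1..n}" for p
    using vector_space_axioms
    by (simp add: Vector_Spaces.linear_iff c(2)[OF p] \<sigma>_add[OF p] \<sigma>_scale[OF p] algebra_simps)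
  have bij: "bij (\<rho> p)" if p: "p permutes {1..n}" for p
  proof (rule bijI)
    show "inj (\<rho> p)" using c[OF p] by (intro injI) (simp add: \<sigma>_cancel[OF p])
    show "surj (\<rho> p)"
    proof (rule surjI)
      fix v
      show "\<rho> p (inv' (\<sigma> p) (scale (\<chi> p) v)) = v"
        using c[OF p] bij_\<sigma>[OF p] by (simp add: \<chi>_def bij_is_surj surj_f_inv_f)
    qed
  qed
  have class_fun: "\<chi> (p \<circ> q \<circ> inv' p) = \<chi> q" if p: "p permutes {1..n}" and q: "q permutes {1..n}" for p q
  proof -
    let ?r = "p \<circ> q \<circ> inv' p"
    have r: "?r permutes {1..n}" using p q by (intro permutes_compose permutes_inv)
    obtain v :: 'v where "v \<noteq> 0" by (rule nontrivial)
    \<comment> \<open>The two sides of the quandle relation at \<open>v\<close> are \<open>\<chi> (p q p\<^sup>-\<^sup>1) w\<close> and \<open>\<chi> q w\<close>.\<close>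
    define w where "w = scale (\<chi> p) (\<rho> p (\<rho> q v))"
    have "\<rho> p 0 = 0" "\<rho> q 0 = 0" by (simp_all add: c(2)[OF p] c(2)[OF q] \<sigma>_0[OF p] \<sigma>_0[OF q])
    then have "\<rho> p (\<rho> q v) \<noteq> 0"
      using \<open>v \<noteq> 0\<close> bij[OF p] bij[OF q] by (metis bij_is_inj injD)
    then have "w \<noteq> 0" by (simp add: w_def \<chi>[OF p])
    have "?r \<circ> p = p \<circ> q" using permutes_inv_o(2)[OF p] by (simp add: comp_assoc)
    then have "\<rho> ?r (\<rho> p v) = \<rho> p (\<rho> q v)" using hom[OF r p] hom[OF p q] by (metis comp_apply)
    moreover have "\<rho> ?r (scale (\<chi> p) u) = scale (\<chi> p) (\<rho> ?r u)" "\<rho> p (scale (\<chi> q) u) = scale (\<chi> q) (\<rho> p u)" for u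
      using lin[OF r] lin[OF p] by (auto simp: Vector_Spaces.linear_iff)
    ultimately have "scale (\<chi> ?r) w = scale (\<chi> q) w"
      using conj_\<sigma>[OF p q, of v] by (simp add: \<sigma>[OF p] \<sigma>[OF q] \<sigma>[OF r] w_def mult.commute)
    then show ?thesis using \<open>w \<noteq> 0\<close> by (simp add: scale_right_imp_eq)
  qed
  show thesis
  proof (rule that[of \<chi> \<rho>])
    show "\<sigma> p = twist scale \<chi> \<rho> p" if "p permutes {1..n}" for p
      using \<sigma>[OF that] by (simp add: twist_def fun_eq_iff)
  qed (use \<chi> class_fun lin bij hom in auto)
qed

end

theorem mainTheorem6:
  fixes n :: nat
    and scale :: "complex \<Rightarrow> 'v::ab_group_add \<Rightarrow> 'v"
    and \<sigma> :: "(nat \<Rightarrow> nat) \<Rightarrow> 'v \<Rightarrow> 'v"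
  assumes "n \<ge> 1" and "vector_space scale"
  shows "irreducible_quandle_rep (Conj (sym_group n)) scale \<sigma> \<longleftrightarrow>
    (\<exists>\<chi> \<rho>. quandle_character (Conj (sym_group n)) \<chi> \<and>
       irreducible_group_rep (sym_group n) scale \<rho> \<and>
       (\<forall>x\<in>carrier (Conj (sym_group n)). \<sigma> x = twist scale \<chi> \<rho> x))"
proof -
  interpret vector_space scale by fact
  let ?G = "sym_group n" let ?S = "{p. p permutes {1..n}}"
  have G: "carrier ?G = ?S" "p \<otimes>\<^bsub>?G\<^esub> q = p \<circ> q" for p q
    by (auto simp: sym_group_def)
  have inv_G: "inv\<^bsub>?G\<^esub> p = inv' p" if "p permutes {1..n}" for p
    using that by (simp add: sym_group_inv_equality sym_group_carrier)
  have rep: "quandle_rep (Conj ?G) scale \<phi> \<longleftrightarrow>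
      (\<forall>p\<in>?S. Vector_Spaces.linear scale scale (\<phi> p) \<and> bij (\<phi> p)) \<and>
      (\<forall>p\<in>?S. \<forall>q\<in>?S. \<phi> (p \<circ> q \<circ> inv' p) \<circ> \<phi> p = \<phi> p \<circ> \<phi> q)" for \<phi>
    unfolding quandle_rep_Conj_iff[OF sym_group_is_group assms(2)] by (simp add: G inv_G)
  have char: "quandle_character (Conj ?G) \<chi> \<longleftrightarrow>
      (\<forall>p\<in>?S. \<chi> p \<noteq> 0) \<and> (\<forall>p\<in>?S. \<forall>q\<in>?S. \<chi> (p \<circ> q \<circ> inv' p) = \<chi> q)" for \<chi>
    by (auto simp: quandle_character_def G inv_G)
  have group: "group_rep ?G scale \<rho> \<longleftrightarrow>
      (\<forall>p\<in>?S. Vector_Spaces.linear scale scale (\<rho> p) \<and> bij (\<rho> p)) \<and>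
      (\<forall>p\<in>?S. \<forall>q\<in>?S. \<rho> (p \<circ> q) = \<rho> p \<circ> \<rho> q)" for \<rho>
    using assms(2) sym_group_is_group by (auto simp: group_rep_def hom_def G GL_def)
  show ?thesis
  proof
    assume "irreducible_quandle_rep (Conj ?G) scale \<sigma>"
    then have q: "quandle_rep (Conj ?G) scale \<sigma>" and irr: "irreducible_action scale ?S \<sigma>"
      by (simp_all add: irreducible_quandle_rep_def G)
    interpret irreducible_conj_rep scale n \<sigma>
      using q irr unfolding rep
      by (intro irreducible_conj_rep.intro irreducible_conj_rep_axioms.intro vector_space_axioms)
        (auto simp: fun_eq_iff)
    obtain \<chi> \<rho> where *: "\<And>p. p permutes {1..n} \<Longrightarrow> \<chi> p \<noteq> 0"
      "\<And>p q. \<lbrakk>p permutes {1..n}; q permutes {1..n}\<rbrakk> \<Longrightarrow> \<chi> (p \<circ> q \<circ> inv' p) = \<chi> q"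
      "\<And>p. p permutes {1..n} \<Longrightarrow> Vector_Spaces.linear scale scale (\<rho> p) \<and> bij (\<rho> p)"
      "\<And>p q. \<lbrakk>p permutes {1..n}; q permutes {1..n}\<rbrakk> \<Longrightarrow> \<rho> (p \<circ> q) = \<rho> p \<circ> \<rho> q"
      "\<And>p. p permutes {1..n} \<Longrightarrow> \<sigma> p = twist scale \<chi> \<rho> p"
      by (rule ex_twist) blast
    have "irreducible_action scale ?S \<rho>"
      using irreducible_action_twist[OF assms(2), of ?S \<chi> \<sigma> \<rho>] irr *(1,5) by blast
    then have "irreducible_group_rep ?G scale \<rho>"
      using *(3,4) by (simp add: irreducible_group_rep_def group G)
    moreover have "quandle_character (Conj ?G) \<chi>" using *(1,2) by (simp add: char)
    ultimately show "\<exists>\<chi> \<rho>. quandle_character (Conj ?G) \<chi> \<and> irreducible_group_rep ?G scale \<rho> \<and>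
        (\<forall>x\<in>carrier (Conj ?G). \<sigma> x = twist scale \<chi> \<rho> x)"
      using *(5) by (intro exI[of _ \<chi>] exI[of _ \<rho>]) (simp add: G)
  next
    assume "\<exists>\<chi> \<rho>. quandle_character (Conj ?G) \<chi> \<and> irreducible_group_rep ?G scale \<rho> \<and>
        (\<forall>x\<in>carrier (Conj ?G). \<sigma> x = twist scale \<chi> \<rho> x)"
    then obtain \<chi> \<rho> where "quandle_character (Conj ?G) \<chi>" and irr: "irreducible_action scale ?S \<rho>"
      and "group_rep ?G scale \<rho>" and \<sigma>_eq: "\<forall>p\<in>?S. \<sigma> p = twist scale \<chi> \<rho> p"
      by (auto simp only: irreducible_group_rep_def G Conj_simps)
    then have \<chi>: "\<chi> p \<noteq> 0" "q \<in> ?S \<Longrightarrow> \<chi> (p \<circ> q \<circ> inv' p) = \<chi> q"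
      and \<rho>: "Vector_Spaces.linear scale scale (\<rho> p)" "bij (\<rho> p)" "q \<in> ?S \<Longrightarrow> \<rho> (p \<circ> q) = \<rho> p \<circ> \<rho> q"
      and \<sigma>: "\<sigma> p = twist scale \<chi> \<rho> p" if "p \<in> ?S" for p q
      using that unfolding char group by blast+
    have \<rho>_scale: "\<rho> p (scale c v) = scale c (\<rho> p v)" if "p \<in> ?S" for p c v
      using \<rho>(1)[OF that] by (auto simp: Vector_Spaces.linear_iff)
    have "irreducible_action scale ?S \<sigma>"
      using irreducible_action_twist[OF assms(2), of ?S \<chi> \<sigma> \<rho>] irr \<chi>(1) \<sigma> by blast
    moreover have "Vector_Spaces.linear scale scale (\<sigma> p)" if p: "p \<in> ?S" for p
      using \<rho>(1)[OF p] by (simp add: Vector_Spaces.linear_iff \<sigma>[OF p] twist_def algebra_simps)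
    moreover have "bij (\<sigma> p)" if p: "p \<in> ?S" for p
    proof -
      have "bij (scale (\<chi> p))"
        using \<chi>(1)[OF p] by (intro bij_betwI[where g = "scale (inverse (\<chi> p))"]) auto
      moreover have "\<sigma> p = scale (\<chi> p) \<circ> \<rho> p" by (simp add: \<sigma>[OF p] twist_def fun_eq_iff)
      ultimately show ?thesis using \<rho>(2)[OF p] bij_comp by metis
    qed
    moreover have "\<sigma> (p \<circ> q \<circ> inv' p) \<circ> \<sigma> p = \<sigma> p \<circ> \<sigma> q" if p: "p \<in> ?S" and q: "q \<in> ?S" for p q
    proof
      fix v
      let ?r = "p \<circ> q \<circ> inv' p"
      have r: "?r \<in> ?S" using p q by (auto intro!: permutes_compose permutes_inv simp del: o_apply)
      have "?r \<circ> p = p \<circ> q" using p permutes_inv_o(2)[of p "{1..n}"] by (simp add: comp_assoc)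
      then have "\<rho> ?r (\<rho> p v) = \<rho> p (\<rho> q v)" using \<rho>(3)[OF r p] \<rho>(3)[OF p q] by (metis comp_apply)
      then show "(\<sigma> ?r \<circ> \<sigma> p) v = (\<sigma> p \<circ> \<sigma> q) v"
        by (simp add: \<sigma>[OF p] \<sigma>[OF q] \<sigma>[OF r] twist_def \<rho>_scale[OF p] \<rho>_scale[OF r] \<chi>(2)[OF p q] mult.commute)
    qed
    ultimately show "irreducible_quandle_rep (Conj ?G) scale \<sigma>"
      by (simp add: irreducible_quandle_rep_def rep G)
  qed
qed

end
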